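(* There is an absolute constant $C>0$ such that for all integers $n,w\ge 1$, every $\varepsilon>0$, and every $f:\{0,1\}^n\to\{0,1\}$ computed by a DNF formula of width $w$, there is a $k$-junta $g:\{0,1\}^n\to\{0,1\}$ with $k\le (w\log(1/\varepsilon))^{Cw}$ that $\varepsilon$-approximates $f$.
   Context: A DNF formula is an OR of terms, each term being an AND of literals; it has width $w$ if every term contains at most $w$ literals (the number of terms is arbitrary). A $k$-junta is a function that depends on at most $k$ of its variables. The function $g$ $\varepsilon$-approximates $f$ if $\Pr_x[f(x)\neq g(x)]\le\varepsilon$ for $x$ uniform in $\{0,1\}^n$. Convention: in the bound on $k$, $\log(y)$ is read as $\max\{2,\log_2 y\}$. *)

theory Defs
  imports "HOL-Probability.Probability_Mass_Function" "HOL-Library.FuncSet"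
begin

text \<open>
  Since the absolute constant must be chosen before \<open>n\<close>, the dimension is a value and not a
  type: points of \<open>{0,1}^n\<close> are the extensional maps from \<open>{..<n}\<close> to \<^typ>\<open>bool\<close>. Boolean functions
  on the cube are total HOL functions; every notion below only looks at their values on \<open>cube n\<close>.
\<close>

definition cube :: "nat \<Rightarrow> (nat \<Rightarrow> bool) set" where
  "cube n = {..<n} \<rightarrow>\<^sub>E UNIV"

datatype literal = Pos (lit_var: nat) | Neg (lit_var: nat)

fun lit_sat :: "(nat \<Rightarrow> bool) \<Rightarrow> literal \<Rightarrow> bool" where
  "lit_sat x (Pos i) = x i"
| "lit_sat x (Neg i) = (\<not> x i)"

type_synonym dnf_term = "literal set"
type_synonym dnf = "dnf_term set"

definition term_sat :: "(nat \<Rightarrow> bool) \<Rightarrow> dnf_term \<Rightarrow> bool" where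
  "term_sat x T \<longleftrightarrow> (\<forall>l\<in>T. lit_sat x l)"

definition dnf_sat :: "(nat \<Rightarrow> bool) \<Rightarrow> dnf \<Rightarrow> bool" where
  "dnf_sat x D \<longleftrightarrow> (\<exists>T\<in>D. term_sat x T)"

definition dnf_formula :: "nat \<Rightarrow> dnf \<Rightarrow> bool" where
  "dnf_formula n D \<longleftrightarrow> finite D \<and> (\<forall>T\<in>D. finite T \<and> lit_var ` T \<subseteq> {..<n})"

definition has_width :: "nat \<Rightarrow> dnf \<Rightarrow> bool" where
  "has_width w D \<longleftrightarrow> (\<forall>T\<in>D. card T \<le> w)"

definition computes :: "nat \<Rightarrow> dnf \<Rightarrow> ((nat \<Rightarrow> bool) \<Rightarrow> bool) \<Rightarrow> bool" where
  "computes n D f \<longleftrightarrow> (\<forall>x\<in>cube n. f x = dnf_sat x D)"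

definition depends_on :: "nat \<Rightarrow> ((nat \<Rightarrow> bool) \<Rightarrow> bool) \<Rightarrow> nat \<Rightarrow> bool" where
  "depends_on n f i \<longleftrightarrow> i < n \<and> (\<exists>x\<in>cube n. f (x(i := \<not> x i)) \<noteq> f x)"

definition junta :: "nat \<Rightarrow> nat \<Rightarrow> ((nat \<Rightarrow> bool) \<Rightarrow> bool) \<Rightarrow> bool" where
  "junta n k g \<longleftrightarrow> card {i. depends_on n g i} \<le> k"

definition approximates ::
  "nat \<Rightarrow> real \<Rightarrow> ((nat \<Rightarrow> bool) \<Rightarrow> bool) \<Rightarrow> ((nat \<Rightarrow> bool) \<Rightarrow> bool) \<Rightarrow> bool" where
  "approximates n \<epsilon> g f \<longleftrightarrow>
     measure_pmf.prob (pmf_of_set (cube n)) {x. f x \<noteq> g x} \<le> \<epsilon>"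

text \<open>The logarithm in the bound on \<open>k\<close> is by convention base 2 and truncated below at 2.\<close>

definition log_trunc :: "real \<Rightarrow> real" where
  "log_trunc y = max 2 (log 2 y)"

end

theory Submission
  imports Defs
begin

text \<open>
  Let \<open>H\<close> be the set of terms \<open>A\<close> of width at most \<open>w\<close> for which \<open>A\<close> true and \<open>f\<close> false is very
  unlikely, with an error allowance that grows as \<open>A\<close> gets shorter, and let \<open>g\<close> be the disjunction of
  the minimal elements of \<open>H\<close>. Every term of the given formula lies in \<open>H\<close>, so \<open>f \<le> g\<close>, and the error is
  at most the number of minimal elements times the allowance. If \<open>H\<close> had too many minimal elements
  of one width, some subfamily would be a robust sunflower: its core \<open>A\<close> is a proper subset of a
  member, and given \<open>A\<close> some member is almost surely true. A union bound over boundedly many members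
  puts \<open>A\<close> into \<open>H\<close>, contradicting minimality.

  A robust sunflower arises from a core whose link is spread. By the second moment method a sparse
  random set contains a member of the link with probability at least one half, and a uniformly
  random set is a union of \<open>t\<close> independent sparse ones, hence fails with probability at most \<open>2\<^sup>-\<^sup>t\<close>.
\<close>

subsection \<open>Random subsets\<close>

text \<open>The expectation of \<open>F\<close> at the random subset of \<open>V\<close> that omits each element independently with
  probability \<open>q\<close>; the omission probability is multiplicative under unions.\<close>

definition biased :: "real \<Rightarrow> 'a set \<Rightarrow> ('a set \<Rightarrow> real) \<Rightarrow> real" where
  "biased q V F = (\<Sum>S\<in>Pow V. (1 - q) ^ card S * q ^ card (V - S) * F S)"

lemma biased_empty [simp]: "biased q {} F = F {}"
  by (simp add: biased_def)

lemma biased_insert: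
  assumes "finite V" "v \<notin> V"
  shows "biased q (insert v V) F = q * biased q V F + (1 - q) * biased q V (\<lambda>S. F (insert v S))"
proof -
  let ?h = "\<lambda>S. (1 - q) ^ card S * q ^ card (insert v V - S) * F S"
  have "biased q (insert v V) F = sum ?h (Pow V) + sum ?h (insert v ` Pow V)"
    unfolding biased_def Pow_insert using assms
    by (intro sum.union_disjoint) auto
  also have "sum ?h (Pow V) = q * biased q V F"
  proof -
    have "card (insert v V - S) = Suc (card (V - S))" if "S \<subseteq> V" for S
    proof -
      have "insert v V - S = insert v (V - S)" using that assms by auto
      then show ?thesis using assms by simp
    qed
    then show ?thesis unfolding biased_def sum_distrib_left by (intro sum.cong) auto
  qed
  also have "sum ?h (insert v ` Pow V) = (1 - q) * biased q V (\<lambda>S. F (insert v S))"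
  proof -
    have "inj_on (insert v) (Pow V)" using assms by (auto simp: inj_on_def)
    then have "sum ?h (insert v ` Pow V) = (\<Sum>S\<in>Pow V. ?h (insert v S))"
      by (simp add: sum.reindex)
    also have "\<dots> = (1 - q) * biased q V (\<lambda>S. F (insert v S))"
      unfolding biased_def sum_distrib_left
    proof (intro sum.cong refl)
      fix S assume S: "S \<in> Pow V"
      then have "finite S" "v \<notin> S" using assms finite_subset by auto
      moreover have "insert v V - insert v S = V - S" using assms by auto
      ultimately show "?h (insert v S) = (1 - q) * ((1 - q) ^ card S * q ^ card (V - S) * F (insert v S))"
        by simp
    qed
    finally show ?thesis .
  qed
  finally show ?thesis .
qed

lemma biased_cong: "(\<And>S. S \<subseteq> V \<Longrightarrow> F S = G S) \<Longrightarrow> biased q V F = biased q V G"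
  unfolding biased_def by (intro sum.cong) auto

lemma biased_add: "biased q V (\<lambda>S. F S + G S) = biased q V F + biased q V G"
  by (simp add: biased_def distrib_left sum.distrib)

lemma biased_cmult: "biased q V (\<lambda>S. c * F S) = c * biased q V F"
  by (simp add: biased_def sum_distrib_left mult_ac)

lemma biased_sum: "biased q V (\<lambda>S. \<Sum>i\<in>I. F i S) = (\<Sum>i\<in>I. biased q V (F i))"
  unfolding biased_def sum_distrib_left by (rule sum.swap)

lemma biased_mono:
  assumes "0 \<le> q" "q \<le> 1" "\<And>S. S \<subseteq> V \<Longrightarrow> F S \<le> G S"
  shows "biased q V F \<le> biased q V G"
  unfolding biased_def using assms by (intro sum_mono mult_left_mono) auto

lemma biased_superset:
  assumes "finite V" "B \<subseteq> V"
  shows "biased q V (\<lambda>S. of_bool (B \<subseteq> S)) = (1 - q) ^ card B"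
  using assms
proof (induction V arbitrary: B rule: finite_induct)
  case (insert v V)
  show ?case
  proof (cases "v \<in> B")
    case True
    \<comment> \<open>A subset of \<open>V\<close> misses \<open>v\<close>, so it cannot contain
      \<open>B\<close>. Zero is written \<open>0 * 0\<close> so that \<open>biased_cmult\<close>
      evaluates it.\<close>
    have "biased q V (\<lambda>S. of_bool (B \<subseteq> S)) = biased q V (\<lambda>S. 0 * 0)"
      using True insert.hyps by (intro biased_cong) auto
    then have "biased q V (\<lambda>S. of_bool (B \<subseteq> S)) = 0" by (simp only: biased_cmult)
    moreover have "(\<lambda>S. of_bool (B \<subseteq> insert v S) :: real) = (\<lambda>S. of_bool (B - {v} \<subseteq> S))"
      by (auto simp: fun_eq_iff)
    moreover have "card B = Suc (card (B - {v}))"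
      using True insert by (metis card_Suc_Diff1 finite.insertI finite_subset)
    moreover have "biased q V (\<lambda>S. of_bool (B - {v} \<subseteq> S)) = (1 - q) ^ card (B - {v})"
      using insert.prems by (intro insert.IH) auto
    ultimately show ?thesis
      using insert.hyps by (simp add: biased_insert)
  next
    case False
    then have "(\<lambda>S. of_bool (B \<subseteq> insert v S) :: real) = (\<lambda>S. of_bool (B \<subseteq> S))"
      by (auto simp: fun_eq_iff)
    moreover have "B \<subseteq> V" using False insert by auto
    ultimately show ?thesis
      using insert by (simp add: biased_insert algebra_simps)
  qed
qed auto

lemma biased_one: "finite V \<Longrightarrow> biased q V (\<lambda>_. 1) = 1"
  using biased_superset[of V "{}" q] by simp

text \<open>An element is missing from the union exactly when both independent sets miss it. The
  induction reveals one element at a time and keeps \<open>F\<close> arbitrary, since it also meets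
  \<open>F\<close> shifted by \<open>insert v\<close>.\<close>

lemma biased_union:
  assumes "finite V"
  shows "biased q V (\<lambda>S. biased q' V (\<lambda>S'. F (S \<union> S'))) = biased (q * q') V F"
  using assms
proof (induction V arbitrary: F rule: finite_induct)
  case (insert v V)
  have "biased q (insert v V) (\<lambda>S. biased q' (insert v V) (\<lambda>S'. F (S \<union> S')))
      = q * (q' * biased (q * q') V F + (1 - q') * biased (q * q') V (\<lambda>S. F (insert v S)))
        + (1 - q) * (q' * biased (q * q') V (\<lambda>S. F (insert v S))
           + (1 - q') * biased (q * q') V (\<lambda>S. F (insert v S)))"
    using insert.hyps
    by (simp add: biased_insert biased_add biased_cmult insert.IH
        insert.IH[where F = "\<lambda>S. F (insert v S)", simplified])
      (simp add: algebra_simps)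
  also have "\<dots> = biased (q * q') (insert v V) F"
    using insert.hyps by (simp add: biased_insert algebra_simps)
  finally show ?case .
qed auto

text \<open>If the union of independent random sets contains no member of \<open>L\<close>, then neither does
  any of the sets; this is what turns a constant failure probability into an exponentially
  small one.\<close>

lemma biased_avoid_power:
  fixes q :: real
  assumes V: "finite V" and q: "0 \<le> q" "q \<le> 1"
  shows "biased (q ^ t) V (\<lambda>S. of_bool (\<forall>T\<in>L. \<not> T \<subseteq> S))
    \<le> biased q V (\<lambda>S. of_bool (\<forall>T\<in>L. \<not> T \<subseteq> S)) ^ t"
proof (induction t)
  case 0
  have "biased 1 V (\<lambda>S. of_bool (\<forall>T\<in>L. \<not> T \<subseteq> S)) \<le> biased 1 V (\<lambda>_. 1)"
    by (intro biased_mono) auto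
  then show ?case using V by (simp add: biased_one)
next
  case (Suc t)
  let ?F = "\<lambda>S. of_bool (\<forall>T\<in>L. \<not> T \<subseteq> S) :: real"
  have qt: "0 \<le> q ^ t" "q ^ t \<le> 1" using q by (auto simp: power_le_one)
  have "biased (q ^ Suc t) V ?F = biased q V (\<lambda>S. biased (q ^ t) V (\<lambda>S'. ?F (S \<union> S')))"
    using biased_union[OF V, where F = ?F and q = q and q' = "q ^ t"] by simp
  also have "\<dots> \<le> biased q V (\<lambda>S. biased (q ^ t) V (\<lambda>S'. ?F S * ?F S'))"
    using q qt by (intro biased_mono) auto
  also have "\<dots> = biased (q ^ t) V ?F * biased q V ?F"
    by (simp only: biased_cmult) (subst mult.commute, simp only: biased_cmult)
  also have "\<dots> \<le> biased q V ?F ^ t * biased q V ?F"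
  proof (intro mult_right_mono Suc.IH)
    have "biased q V (\<lambda>S. 0 * 0) \<le> biased q V ?F" using q by (intro biased_mono) auto
    then show "0 \<le> biased q V ?F" by (simp only: biased_cmult)
  qed
  finally show ?case by (simp add: mult.commute)
qed

subsection \<open>Robust sunflowers\<close>

lemma sum_binomial_Pow:
  fixes y :: real
  assumes "finite T"
  shows "(\<Sum>B\<in>Pow T. y ^ card B) = (1 + y) ^ card T"
proof -
  have "(\<Sum>B\<in>Pow T. y ^ card B) = (\<Sum>B\<in>Pow T. (\<Prod>i\<in>B. y) * (\<Prod>i\<in>T - B. 1))"
    by simp
  also have "\<dots> = (\<Prod>i\<in>T. y + 1)" using prod_add[OF assms, of "\<lambda>_. y" "\<lambda>_. 1"] by simp
  finally show ?thesis by (simp add: add.commute)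
qed

text \<open>This is Chebyshev's inequality for the number of members of \<open>L\<close> contained in the random set.\<close>

lemma spread_avoid_half:
  fixes q r :: real
  assumes V: "finite V" and q: "0 \<le> q" "q < 1"
    and L: "finite L" "L \<noteq> {}" "\<And>T. T \<in> L \<Longrightarrow> T \<subseteq> V \<and> card T = m"
    and spread: "\<And>B. r ^ card B * card {T \<in> L. B \<subseteq> T} \<le> card L"
    and r: "r > 0" "4 * m \<le> r * (1 - q)"
  shows "biased q V (\<lambda>S. of_bool (\<forall>T\<in>L. \<not> T \<subseteq> S)) \<le> 1 / 2"
proof -
  define p where "p = 1 - q"
  define X where "X = (\<lambda>S. \<Sum>T\<in>L. of_bool (T \<subseteq> S) :: real)"
  define \<mu> where "\<mu> = card L * p ^ m"
  have p: "0 < p" "p \<le> 1" using q by (auto simp: p_def)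
  have finT: "finite T" if "T \<in> L" for T using L(3)[OF that] V finite_subset by blast
  have "\<mu> > 0" using L p by (simp add: \<mu>_def card_gt_0_iff)
  have first: "biased q V X = \<mu>"
    unfolding X_def biased_sum using L V by (simp add: biased_superset \<mu>_def p_def)
  \<comment> \<open>The second moment runs over ordered pairs of members; compared with
    independence, each common element costs a factor \<open>1 / p\<close>.\<close>
  have "biased q V (\<lambda>S. X S * X S) = (\<Sum>T\<in>L. \<Sum>T'\<in>L. biased q V (\<lambda>S. of_bool (T \<union> T' \<subseteq> S)))"
    unfolding X_def sum_product biased_sum of_bool_conj[symmetric] Un_subset_iff ..
  also have "\<dots> = (\<Sum>T\<in>L. \<Sum>T'\<in>L. p ^ (2 * m) * (1 / p) ^ card (T \<inter> T'))"
  proof (intro sum.cong refl)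
    fix T T' assume T: "T \<in> L" "T' \<in> L"
    have "card (T \<union> T') + card (T \<inter> T') = 2 * m"
      using card_Un_Int[OF finT[OF T(1)] finT[OF T(2)]] L(3)[OF T(1)] L(3)[OF T(2)] by simp
    then have "p ^ (2 * m) = p ^ card (T \<union> T') * p ^ card (T \<inter> T')"
      by (metis power_add)
    then show "biased q V (\<lambda>S. of_bool (T \<union> T' \<subseteq> S)) = p ^ (2 * m) * (1 / p) ^ card (T \<inter> T')"
      using L(3)[OF T(1)] L(3)[OF T(2)] V p
      by (subst biased_superset) (auto simp: p_def[symmetric] field_simps)
  qed
  also have "\<dots> \<le> (\<Sum>T\<in>L. p ^ (2 * m) * (card L * (1 + 1 / (r * p)) ^ m))"
  proof (intro sum_mono)
    fix T assume T: "T \<in> L"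
    \<comment> \<open>Replacing the overlap factor by a sum over all subsets \<open>B\<close> of the
      overlap lets the spread hypothesis count, for each fixed \<open>B\<close>, the members
      containing it.\<close>
    have "(\<Sum>T'\<in>L. (1 / p) ^ card (T \<inter> T'))
        \<le> (\<Sum>T'\<in>L. \<Sum>B\<in>Pow T. of_bool (B \<subseteq> T') * (1 / p) ^ card B)"
    proof (intro sum_mono)
      fix T'
      have "(1 / p) ^ card (T \<inter> T') = (\<Sum>B\<in>{T \<inter> T'}. of_bool (B \<subseteq> T') * (1 / p) ^ card B)"
        by simp
      also have "\<dots> \<le> (\<Sum>B\<in>Pow T. of_bool (B \<subseteq> T') * (1 / p) ^ card B)"
        using finT[OF T] p by (intro sum_mono2) auto
      finally show "(1 / p) ^ card (T \<inter> T') \<le> \<dots>" .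
    qed
    also have "\<dots> = (\<Sum>B\<in>Pow T. card {T' \<in> L. B \<subseteq> T'} * (1 / p) ^ card B)"
      using L(1) by (subst sum.swap) (simp add: sum_distrib_right[symmetric] Int_def sum_of_bool_eq)
    also have "\<dots> \<le> (\<Sum>B\<in>Pow T. card L * (1 / (r * p)) ^ card B)"
    proof (intro sum_mono)
      fix B
      have "card {T' \<in> L. B \<subseteq> T'} \<le> card L * (1 / r) ^ card B"
        using spread[of B] r by (simp add: field_simps)
      then have "card {T' \<in> L. B \<subseteq> T'} * (1 / p) ^ card B \<le> card L * (1 / r) ^ card B * (1 / p) ^ card B"
        using p by (intro mult_right_mono) auto
      then show "card {T' \<in> L. B \<subseteq> T'} * (1 / p) ^ card B \<le> card L * (1 / (r * p)) ^ card B"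
        by (simp add: power_mult_distrib power_divide)
    qed
    also have "\<dots> = card L * (1 + 1 / (r * p)) ^ m"
      using L(3)[OF T] finT[OF T] by (simp add: sum_distrib_left[symmetric] sum_binomial_Pow)
    finally show "(\<Sum>T'\<in>L. p ^ (2 * m) * (1 / p) ^ card (T \<inter> T'))
        \<le> p ^ (2 * m) * (card L * (1 + 1 / (r * p)) ^ m)"
      using p by (simp add: sum_distrib_left[symmetric])
  qed
  also have "\<dots> = \<mu>\<^sup>2 * (1 + 1 / (r * p)) ^ m"
    by (simp add: \<mu>_def power2_eq_square mult_2 power_add)
  also have "\<dots> \<le> \<mu>\<^sup>2 * (3 / 2)"
  proof (intro mult_left_mono)
    \<comment> \<open>Since \<open>4 * m\<close> is at most \<open>r * p\<close>, the exponent is at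
      most 1/4. The resulting factor 3/2 bounds the variance by half of
      \<open>\<mu>\<^sup>2\<close>.\<close>
    have "(1 + 1 / (r * p)) ^ m \<le> exp (1 / (r * p)) ^ m"
      using r p by (intro power_mono exp_ge_add_one_self) (auto intro: add_nonneg_nonneg)
    also have "\<dots> = exp (m / (r * p))" by (simp add: exp_of_nat_mult[symmetric])
    also have "\<dots> \<le> exp (1 / 4)" using r p by (simp add: p_def field_simps)
    also have "\<dots> \<le> 3 / 2" using exp_bound[of "1/4"] by (simp add: power2_eq_square)
    finally show "(1 + 1 / (r * p)) ^ m \<le> 3 / 2" .
  qed auto
  finally have second: "biased q V (\<lambda>S. X S * X S) \<le> \<mu>\<^sup>2 * (3 / 2)" .
  \<comment> \<open>Chebyshev pointwise: where no member is contained, \<open>X\<close> vanishes and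
    \<open>(X S - \<mu>)\<^sup>2\<close> equals \<open>\<mu>\<^sup>2\<close>.\<close>
  have "\<mu>\<^sup>2 * biased q V (\<lambda>S. of_bool (\<forall>T\<in>L. \<not> T \<subseteq> S))
      = biased q V (\<lambda>S. \<mu>\<^sup>2 * of_bool (\<forall>T\<in>L. \<not> T \<subseteq> S))"
    by (simp add: biased_cmult)
  also have "\<dots> \<le> biased q V (\<lambda>S. X S * X S + ((-2 * \<mu>) * X S + \<mu>\<^sup>2 * 1))"
  proof (intro biased_mono)
    fix S
    have "X S = 0" if "\<forall>T\<in>L. \<not> T \<subseteq> S" using that by (simp add: X_def)
    moreover have "X S * X S + ((-2 * \<mu>) * X S + \<mu>\<^sup>2 * 1) = (X S - \<mu>)\<^sup>2"
      by (simp add: power2_eq_square algebra_simps)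
    ultimately show "\<mu>\<^sup>2 * of_bool (\<forall>T\<in>L. \<not> T \<subseteq> S) \<le> X S * X S + ((-2 * \<mu>) * X S + \<mu>\<^sup>2 * 1)"
      by auto
  qed (use q in auto)
  also have "\<dots> = biased q V (\<lambda>S. X S * X S) - \<mu>\<^sup>2"
    unfolding biased_add biased_cmult first biased_one[OF V] by (simp add: power2_eq_square)
  also have "\<dots> \<le> \<mu>\<^sup>2 * (1 / 2)" using second by simp
  finally show ?thesis using \<open>\<mu> > 0\<close> by simp
qed

text \<open>The uniform set is a union of \<open>t\<close> independent sets with omission
  probability \<open>q\<close>, where \<open>q ^ t = 1 / 2\<close>. By Bernoulli's inequality each
  includes an element with probability at least \<open>1 / (2 * t)\<close>, which turns the
  \<open>4 * m\<close> of the half bound into \<open>8 * m * t\<close>.\<close>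

lemma spread_avoid:
  fixes r t :: nat
  assumes V: "finite V" and t: "t > 0"
    and L: "finite L" "L \<noteq> {}" "\<And>T. T \<in> L \<Longrightarrow> T \<subseteq> V \<and> card T = m"
    and spread: "\<And>B. r ^ card B * card {T \<in> L. B \<subseteq> T} \<le> card L"
    and r: "r > 0" "8 * m * t \<le> r"
  shows "biased (1 / 2) V (\<lambda>S. of_bool (\<forall>T\<in>L. \<not> T \<subseteq> S)) \<le> (1 / 2) ^ t"
proof -
  define q :: real where "q = root t (1 / 2)"
  have q: "0 \<le> q" "q < 1" "q ^ t = 1 / 2"
    using t by (auto simp: q_def)
  have "1 / 2 \<le> (1 - 1 / (2 * t)) ^ t"
    using Bernoulli_inequality[of "- 1 / (2 * t)" t] t by (simp add: field_simps)
  then have "q ^ t \<le> (1 - 1 / (2 * t)) ^ t" using q by simp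
  then have "q \<le> 1 - 1 / (2 * t)"
    using t by (subst (asm) power_mono_iff) (auto simp: q field_simps)
  then have "r * (1 / (2 * t)) \<le> r * (1 - q)"
    by (intro mult_left_mono) auto
  moreover have "4 * m \<le> r * (1 / (2 * t))"
  proof -
    have "real (8 * m * t) \<le> r" using r by (simp only: of_nat_le_iff)
    then show ?thesis using t by (simp add: field_simps)
  qed
  ultimately have "4 * m \<le> r * (1 - q)" by linarith
  moreover have "real r ^ card B * card {T \<in> L. B \<subseteq> T} \<le> card L" for B
    using spread[of B] by (metis of_nat_le_iff of_nat_mult of_nat_power)
  ultimately have "biased q V (\<lambda>S. of_bool (\<forall>T\<in>L. \<not> T \<subseteq> S)) \<le> 1 / 2"
    using assms q by (intro spread_avoid_half[where r = r]) auto
  moreover have "0 \<le> biased q V (\<lambda>S. of_bool (\<forall>T\<in>L. \<not> T \<subseteq> S))"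
    unfolding biased_def using q by (intro sum_nonneg) auto
  ultimately have "biased q V (\<lambda>S. of_bool (\<forall>T\<in>L. \<not> T \<subseteq> S)) ^ t \<le> (1 / 2) ^ t"
    by (intro power_mono)
  moreover have "biased (q ^ t) V (\<lambda>S. of_bool (\<forall>T\<in>L. \<not> T \<subseteq> S))
      \<le> biased q V (\<lambda>S. of_bool (\<forall>T\<in>L. \<not> T \<subseteq> S)) ^ t"
    using V q by (intro biased_avoid_power) auto
  ultimately show ?thesis using q by simp
qed

text \<open>The core is a maximal \<open>A\<close> lying in more than
  \<open>r ^ (j - card A)\<close> members; the empty set qualifies by \<open>big\<close>. Maximality
  makes the link of \<open>A\<close> spread.\<close>

lemma robust_sunflower:
  fixes r t :: nat
  assumes V: "finite V" and t: "t > 0"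
    and G: "finite G" "\<And>T. T \<in> G \<Longrightarrow> T \<subseteq> V \<and> card T = j"
    and r: "r > 0" "8 * j * t \<le> r" and big: "r ^ j < card G"
  obtains A T where "T \<in> G" "A \<subset> T"
    "biased (1 / 2) V (\<lambda>S. of_bool (A \<subseteq> S \<and> (\<forall>T\<in>G. \<not> T \<subseteq> S))) \<le> (1 / 2) ^ t"
proof -
  have finT: "finite T" if "T \<in> G" for T using G(2)[OF that] V finite_subset by blast
  define P where "P A \<longleftrightarrow> A \<subseteq> V \<and> card A \<le> j \<and> r ^ (j - card A) < card {T \<in> G. A \<subseteq> T}" for A
  have "P {}" using big by (simp add: P_def)
  moreover have "finite (Collect P)" using V by (intro finite_subset[of "Collect P" "Pow V"]) (auto simp: P_def)
  ultimately obtain A where PA: "P A" and max: "\<And>A'. P A' \<Longrightarrow> A \<subseteq> A' \<Longrightarrow> A = A'"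
    using finite_has_maximal2[of "Collect P" "{}"] by auto
  then have A: "A \<subseteq> V" "card A \<le> j" "r ^ (j - card A) < card {T \<in> G. A \<subseteq> T}"
    by (simp_all add: P_def)
  define L where "L = (\<lambda>T. T - A) ` {T \<in> G. A \<subseteq> T}"
  have finA: "finite A" using A V finite_subset by blast
  have inj: "inj_on (\<lambda>T. T - A) {T \<in> G. A \<subseteq> T}" by (auto simp: inj_on_def)
  have "card L = card {T \<in> G. A \<subseteq> T}" unfolding L_def by (rule card_image[OF inj])
  then have cardL: "r ^ (j - card A) < card L" using A by simp
  then have "L \<noteq> {}" by auto
  have "finite L" using G by (simp add: L_def)
  obtain T where T: "T \<in> G" "A \<subseteq> T" using \<open>L \<noteq> {}\<close> by (auto simp: L_def)
  \<comment> \<open>All members have size \<open>j\<close>, so a core equal to a member lies in that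
    one only, while the threshold \<open>r ^ 0\<close> demands more than one.\<close>
  have "A \<noteq> T"
  proof
    assume "A = T"
    have "T' = T" if "T' \<in> G" "T \<subseteq> T'" for T'
      using card_subset_eq[OF finT[OF that(1)] that(2)] G(2) that T by auto
    then have "{T \<in> G. A \<subseteq> T} = {T}" using T \<open>A = T\<close> by auto
    moreover have "card T = j" using G(2) T by blast
    ultimately show False using A \<open>A = T\<close> by simp
  qed
  have mem: "T \<subseteq> V \<and> card T = j - card A" if "T \<in> L" for T
    using that G(2) finA by (auto simp: L_def card_Diff_subset)
  have spread: "r ^ card B * card {T \<in> L. B \<subseteq> T} \<le> card L" for B
  proof (cases "B = {} \<or> {T \<in> L. B \<subseteq> T} = {}")
    case False
    then obtain T' where T': "T' \<in> L" "B \<subseteq> T'" by auto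
    then have B: "B \<inter> A = {}" "B \<subseteq> V" "finite B" "B \<noteq> {}"
      using mem[of T'] V False by (auto simp: L_def finite_subset)
    have "card B \<le> card T'" using T' mem[of T'] V by (intro card_mono) (auto intro: finite_subset)
    then have cAB: "card (A \<union> B) = card A + card B" "card B \<le> j - card A"
      using B finA mem[OF T'(1)] by (auto simp: card_Un_disjoint Int_commute)
    have "{T \<in> L. B \<subseteq> T} = (\<lambda>T. T - A) ` {T \<in> G. A \<union> B \<subseteq> T}"
      using B by (auto simp: L_def)
    moreover have "inj_on (\<lambda>T. T - A) {T \<in> G. A \<union> B \<subseteq> T}" by (auto simp: inj_on_def)
    ultimately have "card {T \<in> L. B \<subseteq> T} = card {T \<in> G. A \<union> B \<subseteq> T}"
      by (simp add: card_image)
    \<comment> \<open>\<open>B\<close> is nonempty and disjoint from \<open>A\<close>, so exceeding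
      this threshold would give a strictly larger core.\<close>
    also have "\<dots> \<le> r ^ (j - card (A \<union> B))"
    proof (rule ccontr)
      assume "\<not> ?thesis"
      then have "P (A \<union> B)" using A B cAB by (auto simp: P_def)
      then have "A = A \<union> B" by (intro max) auto
      then show False using B by auto
    qed
    finally have "r ^ card B * card {T \<in> L. B \<subseteq> T} \<le> r ^ card B * r ^ (j - card (A \<union> B))"
      by simp
    also have "\<dots> = r ^ (card B + (j - card (A \<union> B)))" by (simp add: power_add)
    also have "card B + (j - card (A \<union> B)) = j - card A" using cAB by simp
    finally show ?thesis using cardL by simp
  next
    case True
    then show ?thesis by (elim disjE) (simp_all del: Collect_empty_eq)
  qed
  have "8 * (j - card A) * t \<le> 8 * j * t" by (intro mult_le_mono) auto
  then have "8 * (j - card A) * t \<le> r" using r(2) by (rule order.trans)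
  then have "biased (1 / 2) V (\<lambda>S. of_bool (\<forall>T\<in>L. \<not> T \<subseteq> S)) \<le> (1 / 2) ^ t"
    using V t \<open>finite L\<close> \<open>L \<noteq> {}\<close> mem spread r by (intro spread_avoid[where r = r and m = "j - card A"]) auto
  moreover have "biased (1 / 2) V (\<lambda>S. of_bool (A \<subseteq> S \<and> (\<forall>T\<in>G. \<not> T \<subseteq> S)))
      \<le> biased (1 / 2) V (\<lambda>S. of_bool (\<forall>T\<in>L. \<not> T \<subseteq> S))"
  proof (intro biased_mono)
    fix S
    have "A \<subseteq> S \<and> (\<forall>T\<in>G. \<not> T \<subseteq> S) \<longrightarrow> (\<forall>T\<in>L. \<not> T \<subseteq> S)"
      unfolding L_def by blast
    then show "of_bool (A \<subseteq> S \<and> (\<forall>T\<in>G. \<not> T \<subseteq> S)) \<le> (of_bool (\<forall>T\<in>L. \<not> T \<subseteq> S) :: real)"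
      unfolding of_bool_less_eq_iff .
  qed auto
  ultimately show ?thesis using T \<open>A \<noteq> T\<close> by (intro that[of T A]) auto
qed

subsection \<open>The uniform measure on the cube\<close>

text \<open>A counting form that keeps union bounds elementary; \<open>prob_pmf_of_set_cube\<close>
  ties it to the measure in \<open>approximates\<close>.\<close>

definition cube_prob :: "nat \<Rightarrow> ((nat \<Rightarrow> bool) \<Rightarrow> bool) \<Rightarrow> real" where
  "cube_prob n Q = card {x \<in> cube n. Q x} / 2 ^ n"

lemma finite_cube [simp]: "finite (cube n)"
  by (simp add: cube_def finite_PiE)

lemma card_cube: "card (cube n) = 2 ^ n"
  by (simp add: cube_def card_PiE)

lemma cube_prob_mono: "(\<And>x. x \<in> cube n \<Longrightarrow> P x \<Longrightarrow> Q x) \<Longrightarrow> cube_prob n P \<le> cube_prob n Q"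
  unfolding cube_prob_def by (intro divide_right_mono of_nat_mono card_mono) auto

lemma cube_prob_disj: "cube_prob n (\<lambda>x. P x \<or> Q x) \<le> cube_prob n P + cube_prob n Q"
proof -
  have "{x \<in> cube n. P x \<or> Q x} = {x \<in> cube n. P x} \<union> {x \<in> cube n. Q x}" by auto
  then have "card {x \<in> cube n. P x \<or> Q x} \<le> card {x \<in> cube n. P x} + card {x \<in> cube n. Q x}"
    by (simp add: card_Un_le)
  then show ?thesis
    unfolding cube_prob_def add_divide_distrib[symmetric] of_nat_add[symmetric]
    by (intro divide_right_mono) (simp_all only: of_nat_le_iff, simp)
qed

lemma cube_prob_bex:
  fixes c :: real
  assumes "finite I" "\<And>i. i \<in> I \<Longrightarrow> cube_prob n (P i) \<le> c"
  shows "cube_prob n (\<lambda>x. \<exists>i\<in>I. P i x) \<le> card I * c"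
  using assms
proof (induction I rule: finite_induct)
  case (insert i I)
  have "cube_prob n (\<lambda>x. \<exists>i\<in>insert i I. P i x) \<le> cube_prob n (P i) + cube_prob n (\<lambda>x. \<exists>i\<in>I. P i x)"
    using cube_prob_disj by simp
  then show ?case using insert by (fastforce simp: algebra_simps)
qed (simp add: cube_prob_def)

lemma prob_pmf_of_set_cube: "measure_pmf.prob (pmf_of_set (cube n)) {x. Q x} = cube_prob n Q"
proof -
  have "cube n \<noteq> {}" using card_cube[of n] by auto
  then show ?thesis
    by (simp add: measure_pmf_of_set cube_prob_def card_cube Int_def)
qed

section \<open>Points of the cube as subsets of the literals true at a base point\<close>

definition true_literals :: "nat \<Rightarrow> (nat \<Rightarrow> bool) \<Rightarrow> literal set" where
  "true_literals n z = {l. lit_var l < n \<and> lit_sat z l}"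

lemma lit_sat_cong: "x (lit_var l) = y (lit_var l) \<Longrightarrow> lit_sat x l = lit_sat y l"
  by (cases l) auto

lemma bij_betw_true_literals: "bij_betw lit_var (true_literals n z) {..<n}"
  unfolding bij_betw_def
proof
  show "inj_on lit_var (true_literals n z)"
    unfolding inj_on_def true_literals_def
  proof safe
    fix k l assume "lit_sat z k" "lit_sat z l" "lit_var k = lit_var l"
    then show "k = l" by (cases k; cases l) auto
  qed
  have "i \<in> lit_var ` true_literals n z" if "i < n" for i
    using that by (intro image_eqI[of _ _ "if z i then Pos i else Neg i"]) (auto simp: true_literals_def)
  then show "lit_var ` true_literals n z = {..<n}" by (auto simp: true_literals_def)
qed

lemma finite_true_literals [simp]: "finite (true_literals n z)"
  using bij_betw_finite[OF bij_betw_true_literals] by simp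

lemma card_true_literals: "card (true_literals n z) = n"
  using bij_betw_same_card[OF bij_betw_true_literals] by simp

text \<open>A point is determined by the variables where it agrees with \<open>z\<close>;
  surjectivity follows by counting, both sides having \<open>2 ^ n\<close> elements.\<close>

lemma bij_betw_cube:
  "bij_betw (\<lambda>x. {l \<in> true_literals n z. lit_sat x l}) (cube n) (Pow (true_literals n z))"
proof -
  let ?h = "\<lambda>x. {l \<in> true_literals n z. lit_sat x l}"
  have inj: "inj_on ?h (cube n)"
  proof (intro inj_onI)
    fix x y assume xy: "x \<in> cube n" "y \<in> cube n" "?h x = ?h y"
    have "x i = y i" if "i < n" for i
    proof -
      define l where "l = (if z i then Pos i else Neg i)"
      have "l \<in> true_literals n z" using that by (auto simp: l_def true_literals_def)
      then have "lit_sat x l = lit_sat y l" using xy(3) by blast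
      then show ?thesis by (auto simp: l_def split: if_splits)
    qed
    then show "x = y" using xy by (intro PiE_ext[of x "{..<n}" "\<lambda>_. UNIV" y]) (auto simp: cube_def)
  qed
  have "?h ` cube n = Pow (true_literals n z)"
    by (intro card_subset_eq) (auto simp: card_image[OF inj] card_cube card_Pow card_true_literals)
  then show ?thesis using inj by (simp add: bij_betw_def)
qed

text \<open>At omission probability 1/2 all subsets have equal weight. This carries the estimates
  for random sets over to the cube.\<close>

lemma cube_prob_eq_biased:
  "cube_prob n (\<lambda>x. Q {l \<in> true_literals n z. lit_sat x l})
    = biased (1 / 2) (true_literals n z) (\<lambda>S. of_bool (Q S))"
proof -
  let ?V = "true_literals n z"
  let ?h = "\<lambda>x. {l \<in> ?V. lit_sat x l}"
  have "biased (1 / 2) ?V (\<lambda>S. of_bool (Q S)) = (\<Sum>S\<in>Pow ?V. (1 / 2) ^ n * of_bool (Q S))"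
    unfolding biased_def
  proof (intro sum.cong refl)
    fix S assume S: "S \<in> Pow ?V"
    then have "card S + card (?V - S) = n"
      using card_true_literals[of n z] by (metis PowD card_Diff_subset card_mono finite_true_literals le_add_diff_inverse rev_finite_subset)
    then show "(1 - 1 / 2) ^ card S * (1 / 2) ^ card (?V - S) * of_bool (Q S) = (1 / 2 :: real) ^ n * of_bool (Q S)"
      by (simp flip: power_add)
  qed
  also have "\<dots> = (1 / 2) ^ n * (\<Sum>x\<in>cube n. of_bool (Q (?h x)))"
    unfolding sum_distrib_left[symmetric] sum.reindex_bij_betw[OF bij_betw_cube, symmetric] ..
  also have "\<dots> = cube_prob n (\<lambda>x. Q (?h x))"
    by (simp add: cube_prob_def power_divide Int_def)
  finally show ?thesis by simp
qed

lemma term_sat_iff_subset: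
  "T \<subseteq> true_literals n z \<Longrightarrow> term_sat x T \<longleftrightarrow> T \<subseteq> {l \<in> true_literals n z. lit_sat x l}"
  by (auto simp: term_sat_def)

lemma subset_true_literals:
  "lit_var ` T \<subseteq> {..<n} \<Longrightarrow> term_sat z T \<Longrightarrow> T \<subseteq> true_literals n z"
  by (auto simp: true_literals_def term_sat_def)

text \<open>The point \<open>z\<close> rules out contradictory terms and serves as the base point
  that makes \<open>T\<close> a set of independent fair literals.\<close>

lemma cube_prob_term_sat:
  assumes "lit_var ` T \<subseteq> {..<n}" "term_sat z T"
  shows "cube_prob n (\<lambda>x. term_sat x T) = (1 / 2) ^ card T"
proof -
  have "T \<subseteq> true_literals n z" using assms by (rule subset_true_literals)
  then have "cube_prob n (\<lambda>x. term_sat x T)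
      = cube_prob n (\<lambda>x. T \<subseteq> {l \<in> true_literals n z. lit_sat x l})"
    by (simp only: term_sat_iff_subset)
  also have "\<dots> = (1 / 2) ^ card T"
    using \<open>T \<subseteq> _\<close> by (subst cube_prob_eq_biased) (simp add: biased_superset)
  finally show ?thesis .
qed

text \<open>Terms satisfied by a common point are mutually consistent, so the random set argument applies
  to them as subsets of the literals true at that point.\<close>

lemma exists_point_satisfying_many:
  assumes G: "finite G"
    "\<And>T. T \<in> G \<Longrightarrow> lit_var ` T \<subseteq> {..<n} \<and> card T = j \<and> (\<exists>x. term_sat x T)"
  obtains z where "card G \<le> 2 ^ j * card {T \<in> G. term_sat z T}"
proof (rule ccontr)
  assume "\<not> thesis"
  then have less: "2 ^ j * card {T \<in> G. term_sat z T} < card G" for z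
    using that by (meson not_less)
  \<comment> \<open>Averaging: each term holds on a \<open>2^-j\<close> fraction of the cube, so
    double counting pairs of a point and a term contradicts \<open>less\<close>.\<close>
  have "(\<Sum>z\<in>cube n. real (card {T \<in> G. term_sat z T}))
      = (\<Sum>z\<in>cube n. \<Sum>T\<in>G. of_bool (term_sat z T))"
    using G by (simp add: Int_def)
  also have "\<dots> = (\<Sum>T\<in>G. real (card {z \<in> cube n. term_sat z T}))"
    by (subst sum.swap) (simp add: Int_def)
  also have "\<dots> = (\<Sum>T\<in>G. 2 ^ n / 2 ^ j)"
  proof (intro sum.cong refl)
    fix T assume T: "T \<in> G"
    then obtain x where "term_sat x T" using G by blast
    then have "cube_prob n (\<lambda>x. term_sat x T) = (1 / 2) ^ j"
      using G(2)[OF T] cube_prob_term_sat by auto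
    then show "real (card {z \<in> cube n. term_sat z T}) = 2 ^ n / 2 ^ j"
      by (simp add: cube_prob_def field_simps)
  qed
  finally have "(\<Sum>z\<in>cube n. real (2 ^ j * card {T \<in> G. term_sat z T})) = (\<Sum>z\<in>cube n. real (card G))"
    by (simp add: sum_distrib_left[symmetric] card_cube)
  moreover have "(\<Sum>z\<in>cube n. real (2 ^ j * card {T \<in> G. term_sat z T})) < (\<Sum>z\<in>cube n. real (card G))"
    using less card_cube[of n] by (intro sum_strict_mono) (auto simp only: of_nat_less_iff finite_cube, auto)
  ultimately show False by simp
qed

subsection \<open>Sparsification\<close>

text \<open>Passing to the terms true at one popular point costs a factor \<open>2 ^ j\<close>,
  hence the \<open>2 * r\<close> in \<open>big\<close>. The survivors are cut to
  \<open>r ^ j + 1\<close>, just above the sunflower threshold, so that a union bound over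
  \<open>G'\<close> does not depend on \<open>card G\<close>.\<close>

lemma robust_core:
  fixes r t :: nat
  assumes t: "t > 0" and r: "r > 0" "8 * j * t \<le> r"
    and G: "finite G"
      "\<And>T. T \<in> G \<Longrightarrow> lit_var ` T \<subseteq> {..<n} \<and> card T = j \<and> (\<exists>x. term_sat x T)"
    and big: "(2 * r) ^ j < card G"
  obtains A T G' where "T \<in> G" "A \<subset> T" "G' \<subseteq> G" "card G' = Suc (r ^ j)"
    "cube_prob n (\<lambda>x. term_sat x A \<and> (\<forall>T\<in>G'. \<not> term_sat x T)) \<le> (1 / 2) ^ t"
proof -
  obtain z where z: "card G \<le> 2 ^ j * card {T \<in> G. term_sat z T}"
    using exists_point_satisfying_many[OF G] by blast
  have "2 ^ j * r ^ j < card G" using big by (simp add: power_mult_distrib)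
  also note z
  finally have "Suc (r ^ j) \<le> card {T \<in> G. term_sat z T}" by simp
  then obtain G' where G': "G' \<subseteq> {T \<in> G. term_sat z T}" "card G' = Suc (r ^ j)" "finite G'"
    by (rule obtain_subset_with_card_n)
  define V where "V = true_literals n z"
  have mem: "T \<subseteq> V \<and> card T = j" if "T \<in> G'" for T
  proof -
    have "T \<in> G" "term_sat z T" using that G'(1) by blast+
    then show ?thesis using G(2)[of T] subset_true_literals[of T n z] by (simp add: V_def)
  qed
  obtain A T where AT: "T \<in> G'" "A \<subset> T"
    "biased (1 / 2) V (\<lambda>S. of_bool (A \<subseteq> S \<and> (\<forall>T\<in>G'. \<not> T \<subseteq> S))) \<le> (1 / 2) ^ t"
  proof (rule robust_sunflower[OF _ t G'(3) mem r])
    show "finite V" by (simp add: V_def)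
    show "r ^ j < card G'" using G'(2) by simp
  qed
  have A_iff: "term_sat x A \<longleftrightarrow> A \<subseteq> {l \<in> true_literals n z. lit_sat x l}" for x
    using mem[OF AT(1)] AT(2) unfolding V_def by (intro term_sat_iff_subset) blast
  have T_iff: "term_sat x T \<longleftrightarrow> T \<subseteq> {l \<in> true_literals n z. lit_sat x l}" if "T \<in> G'" for x T
    using mem[OF that] unfolding V_def by (intro term_sat_iff_subset) blast
  have "(\<lambda>x. term_sat x A \<and> (\<forall>T\<in>G'. \<not> term_sat x T))
      = (\<lambda>x. A \<subseteq> {l \<in> true_literals n z. lit_sat x l} \<and> (\<forall>T\<in>G'. \<not> T \<subseteq> {l \<in> true_literals n z. lit_sat x l}))"
    by (simp only: A_iff T_iff cong: ball_cong)
  then have "cube_prob n (\<lambda>x. term_sat x A \<and> (\<forall>T\<in>G'. \<not> term_sat x T)) \<le> (1 / 2) ^ t"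
    using AT(3) cube_prob_eq_biased[of n "\<lambda>S. A \<subseteq> S \<and> (\<forall>T\<in>G'. \<not> T \<subseteq> S)" z]
    unfolding V_def by (simp only:)
  moreover have "T \<in> G" "G' \<subseteq> G" using AT(1) G'(1) by blast+
  ultimately show ?thesis using that AT(2) G'(2) by blast
qed

lemma dnf_sparsification:
  fixes r t w :: nat
  assumes w: "w \<ge> 1" and t: "t > 0" and r: "r > 0" "8 * w * t \<le> r"
    and D: "dnf_formula n D" "has_width w D"
  defines "M \<equiv> (2 * r) ^ w"
  obtains G where "dnf_formula n G" "has_width w G" "card G \<le> (w + 1) * M"
    "cube_prob n (\<lambda>x. dnf_sat x D \<noteq> dnf_sat x G) \<le> real ((w + 1) * M * (2 * M) ^ w) * (1 / 2) ^ t"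
proof -
  \<comment> \<open>Each removed literal raises the allowance by a factor \<open>2 * M\<close>,
    which pays for a union bound over at most \<open>M\<close> members plus the sunflower
    failure.\<close>
  define d where "d j = real ((2 * M) ^ (w - j)) * (1 / 2) ^ t" for j
  \<comment> \<open>Satisfiability is demanded because the popular point argument needs consistent
    terms.\<close>
  define H where "H = {A. lit_var ` A \<subseteq> {..<n} \<and> card A \<le> w \<and> (\<exists>x. term_sat x A)
    \<and> cube_prob n (\<lambda>x. term_sat x A \<and> \<not> dnf_sat x D) \<le> d (card A)}"
  define G where "G = {A \<in> H. \<forall>B\<in>H. B \<subseteq> A \<longrightarrow> B = A}"
  define U where "U = {l. lit_var l < n}"
  have "U \<subseteq> Pos ` {..<n} \<union> Neg ` {..<n}"
  proof
    fix l assume "l \<in> U"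
    then show "l \<in> Pos ` {..<n} \<union> Neg ` {..<n}" by (cases l) (auto simp: U_def)
  qed
  then have U: "finite U" by (rule finite_subset) simp
  have HU: "A \<subseteq> U" "finite A" if "A \<in> H" for A
    using that finite_subset[OF _ U] by (auto simp: H_def U_def)
  have "H \<subseteq> Pow U" using HU by blast
  then have finH: "finite H" using U by (meson finite_Pow_iff finite_subset)
  then have finG: "finite G" by (simp add: G_def)
  have M: "M \<ge> 1" using r by (simp add: M_def)
  have d_nonneg: "0 \<le> d j" for j by (simp add: d_def)
  have nearG: "cube_prob n (\<lambda>x. term_sat x A \<and> \<not> dnf_sat x D) \<le> d (card A)" if "A \<in> G" for A
    using that unfolding G_def H_def by blast
  \<comment> \<open>Sunflowers need members of equal size, so each size is treated separately;
    \<open>M\<close> dominates \<open>(2 * r) ^ j\<close> for all of them.\<close>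
  have layer: "card {A \<in> G. card A = j} \<le> M" if j: "j \<le> w" for j
  proof (rule ccontr)
    assume "\<not> ?thesis"
    then have "M < card {A \<in> G. card A = j}" by simp
    moreover have "(2 * r) ^ j \<le> M" unfolding M_def using j r by (intro power_increasing) auto
    ultimately have big: "(2 * r) ^ j < card {A \<in> G. card A = j}" by linarith
    have "8 * j * t \<le> 8 * w * t" using j by (intro mult_le_mono) auto
    then have r': "8 * j * t \<le> r" using r(2) by (rule order.trans)
    have mem: "lit_var ` T \<subseteq> {..<n} \<and> card T = j \<and> (\<exists>x. term_sat x T)"
      if "T \<in> {A \<in> G. card A = j}" for T
      using that by (auto simp: G_def H_def)
    have "finite {A \<in> G. card A = j}" using finG by simp
    then obtain A T G' where A: "T \<in> {A \<in> G. card A = j}" "A \<subset> T" "G' \<subseteq> {A \<in> G. card A = j}"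
      "card G' = Suc (r ^ j)"
      "cube_prob n (\<lambda>x. term_sat x A \<and> (\<forall>T\<in>G'. \<not> term_sat x T)) \<le> (1 / 2) ^ t"
      by (rule robust_core[OF t r(1) r' _ mem big])
    have TH: "T \<in> H" using A by (auto simp: G_def)
    then have cA: "card A < j" using A HU psubset_card_mono by blast
    \<comment> \<open>As \<open>w\<close> is at least 1, the factor \<open>2 ^ w\<close> in
      \<open>M\<close> absorbs the one extra member.\<close>
    have "Suc (r ^ j) \<le> M"
    proof -
      have "r ^ j \<le> r ^ w" using j r by (intro power_increasing) auto
      moreover have "2 * r ^ w \<le> 2 ^ w * r ^ w"
        using w power_increasing[of 1 w "2::nat"] by (intro mult_right_mono) auto
      moreover have "1 \<le> r ^ w" using r by simp
      ultimately show ?thesis unfolding M_def power_mult_distrib by linarith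
    qed
    have "G' \<subseteq> G" using A(3) by blast
    then have finG': "finite G'" using finG by (rule finite_subset)
    have near: "cube_prob n (\<lambda>x. term_sat x T \<and> \<not> dnf_sat x D) \<le> d j" if "T \<in> G'" for T
    proof -
      have "T \<in> G" "card T = j" using A(3) that by blast+
      then show ?thesis using nearG by blast
    qed
    \<comment> \<open>If \<open>A\<close> holds and \<open>D\<close> fails, then either all of
      \<open>G'\<close> fails, which is rare by the choice of the core, or some member of
      \<open>G'\<close> errs, which is rare because it lies in \<open>H\<close>.\<close>
    have "cube_prob n (\<lambda>x. term_sat x A \<and> \<not> dnf_sat x D)
        \<le> cube_prob n (\<lambda>x. (term_sat x A \<and> (\<forall>T\<in>G'. \<not> term_sat x T))
            \<or> (\<exists>T\<in>G'. term_sat x T \<and> \<not> dnf_sat x D))"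
      by (intro cube_prob_mono) auto
    also have "\<dots> \<le> cube_prob n (\<lambda>x. term_sat x A \<and> (\<forall>T\<in>G'. \<not> term_sat x T))
        + cube_prob n (\<lambda>x. \<exists>T\<in>G'. term_sat x T \<and> \<not> dnf_sat x D)"
      by (rule cube_prob_disj)
    also have "\<dots> \<le> (1 / 2) ^ t + card G' * d j"
      using A(5) cube_prob_bex[of G' n "\<lambda>T x. term_sat x T \<and> \<not> dnf_sat x D", OF finG' near] by linarith
    also have "\<dots> \<le> (1 / 2) ^ t + M * d j"
      unfolding A(4) using \<open>Suc (r ^ j) \<le> M\<close>
      by (intro add_left_mono mult_right_mono of_nat_mono d_nonneg)
    also have "\<dots> \<le> d (card A)"
    proof -
      have "1 \<le> M * (2 * M) ^ (w - j)" using M by (simp add: Suc_le_eq)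
      then have "1 + M * (2 * M) ^ (w - j) \<le> (2 * M) ^ Suc (w - j)"
        unfolding power_Suc mult.assoc by linarith
      also have "\<dots> \<le> (2 * M) ^ (w - card A)" using M cA j by (intro power_increasing) auto
      finally have "real (1 + M * (2 * M) ^ (w - j)) \<le> real ((2 * M) ^ (w - card A))"
        by (simp only: of_nat_le_iff)
      then have "real (1 + M * (2 * M) ^ (w - j)) * (1 / 2) ^ t \<le> d (card A)"
        unfolding d_def by (intro mult_right_mono) auto
      then show ?thesis by (simp add: d_def algebra_simps)
    qed
    \<comment> \<open>Variables and satisfiability pass from \<open>T\<close> to its subset
      \<open>A\<close>, which then contradicts the minimality of \<open>T\<close>.\<close>
    finally have "A \<in> H"
      using TH A(2) cA j by (auto simp: H_def term_sat_def)
    then show False using A(1,2) by (auto simp: G_def)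
  qed
  have card_le: "card A \<le> w" if "A \<in> G" for A using that by (auto simp: G_def H_def)
  have "G = (\<Union>j\<le>w. {A \<in> G. card A = j})" using card_le by auto
  then have "card G \<le> (\<Sum>j\<le>w. card {A \<in> G. card A = j})"
    using card_UN_le[of "{..w}" "\<lambda>j. {A \<in> G. card A = j}"] by simp
  also have "\<dots> \<le> (\<Sum>j\<le>w. M)" using layer by (intro sum_mono) auto
  finally have cardG: "card G \<le> (w + 1) * M" by simp
  \<comment> \<open>The error is one-sided: a term of \<open>D\<close> true at \<open>x\<close>
    never errs, so it lies in \<open>H\<close>, and a minimal element below it is also true at
    \<open>x\<close>.\<close>
  have error: "dnf_sat x D \<noteq> dnf_sat x G \<Longrightarrow> \<exists>A\<in>G. term_sat x A \<and> \<not> dnf_sat x D" for x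
  proof -
    have "dnf_sat x G" if sat: "dnf_sat x D"
    proof -
      obtain T where T: "T \<in> D" "term_sat x T" using sat by (auto simp: dnf_sat_def)
      then have "cube_prob n (\<lambda>x. term_sat x T \<and> \<not> dnf_sat x D) = 0"
        by (auto simp: cube_prob_def dnf_sat_def)
      then have "T \<in> H"
        using T D d_nonneg by (auto simp: H_def dnf_formula_def has_width_def)
      then obtain A where "A \<in> H" "A \<subseteq> T" "\<forall>B\<in>H. B \<subseteq> A \<longrightarrow> A = B"
        using finite_has_minimal2[OF finH] by blast
      then have "A \<in> G" "term_sat x A" using T by (auto simp: G_def term_sat_def)
      then show ?thesis by (auto simp: dnf_sat_def)
    qed
    then show "dnf_sat x D \<noteq> dnf_sat x G \<Longrightarrow> \<exists>A\<in>G. term_sat x A \<and> \<not> dnf_sat x D"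
      by (auto simp: dnf_sat_def[of x G])
  qed
  have "cube_prob n (\<lambda>x. dnf_sat x D \<noteq> dnf_sat x G)
      \<le> cube_prob n (\<lambda>x. \<exists>A\<in>G. term_sat x A \<and> \<not> dnf_sat x D)"
    using error by (intro cube_prob_mono) auto
  also have "\<dots> \<le> card G * d 0"
  proof (intro cube_prob_bex finG)
    fix A assume "A \<in> G"
    then have "cube_prob n (\<lambda>x. term_sat x A \<and> \<not> dnf_sat x D) \<le> d (card A)"
      by (rule nearG)
    also have "\<dots> \<le> d 0"
      unfolding d_def using M by (intro mult_right_mono of_nat_mono power_increasing) auto
    finally show "cube_prob n (\<lambda>x. term_sat x A \<and> \<not> dnf_sat x D) \<le> d 0" .
  qed
  also have "\<dots> \<le> real ((w + 1) * M) * d 0"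
    using cardG d_nonneg by (intro mult_right_mono) (simp_all only: of_nat_le_iff)
  also have "\<dots> = real ((w + 1) * M * (2 * M) ^ w) * (1 / 2) ^ t" by (simp add: d_def)
  finally have prob: "cube_prob n (\<lambda>x. dnf_sat x D \<noteq> dnf_sat x G)
      \<le> real ((w + 1) * M * (2 * M) ^ w) * (1 / 2) ^ t" .
  have "dnf_formula n G"
    unfolding dnf_formula_def
  proof (intro conjI ballI finG)
    fix T assume "T \<in> G"
    then have TH: "T \<in> H" by (simp add: G_def)
    then show "finite T" by (rule HU)
    show "lit_var ` T \<subseteq> {..<n}" using TH unfolding H_def by blast
  qed
  moreover have "has_width w G" using card_le by (simp add: has_width_def)
  ultimately show ?thesis using cardG prob that by blast
qed

section \<open>From few terms to a junta, and the choice of parameters\<close>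

lemma junta_dnf:
  assumes "dnf_formula n G" "has_width w G"
  shows "junta n (w * card G) (\<lambda>x. dnf_sat x G)"
proof -
  have fin: "finite G" "\<And>T. T \<in> G \<Longrightarrow> finite T" using assms by (auto simp: dnf_formula_def)
  have "{i. depends_on n (\<lambda>x. dnf_sat x G) i} \<subseteq> (\<Union>T\<in>G. lit_var ` T)"
  proof (rule subsetI, rule ccontr)
    fix i assume "i \<in> {i. depends_on n (\<lambda>x. dnf_sat x G) i}"
    then obtain x where "dnf_sat (x(i := \<not> x i)) G \<noteq> dnf_sat x G"
      unfolding depends_on_def by blast
    moreover assume i: "i \<notin> (\<Union>T\<in>G. lit_var ` T)"
    have "lit_sat (x(i := \<not> x i)) l = lit_sat x l" if "T \<in> G" "l \<in> T" for T l
      using i that by (intro lit_sat_cong) auto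
    ultimately show False by (auto simp: dnf_sat_def term_sat_def)
  qed
  then have "card {i. depends_on n (\<lambda>x. dnf_sat x G) i} \<le> card (\<Union>T\<in>G. lit_var ` T)"
    using fin by (intro card_mono) auto
  also have "\<dots> \<le> (\<Sum>T\<in>G. card (lit_var ` T))" using fin by (intro card_UN_le)
  also have "\<dots> \<le> (\<Sum>T\<in>G. w)"
  proof (intro sum_mono)
    fix T assume T: "T \<in> G"
    then have "card (lit_var ` T) \<le> card T" using fin by (intro card_image_le)
    also have "\<dots> \<le> w" using assms T by (simp add: has_width_def)
    finally show "card (lit_var ` T) \<le> w" .
  qed
  finally show ?thesis by (simp add: junta_def mult.commute)
qed

text \<open>Here \<open>2 ^ u\<close> is the inverse of the target error. Although \<open>M\<close>
  involves \<open>t\<close>, crude estimates bound the base-2 logarithm of the left side by a cubic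
  in \<open>u\<close>, which \<open>32 * u ^ 3\<close> dominates.\<close>

lemma parameter_error:
  fixes w u :: nat
  assumes w: "w \<ge> 1" and u: "2 * w \<le> u"
  defines "t \<equiv> 32 * u ^ 3"
  defines "M \<equiv> (2 * (8 * w * t)) ^ w"
  shows "(w + 1) * M * (2 * M) ^ w * 2 ^ u \<le> 2 ^ t"
proof -
  have u2: "2 \<le> u" using w u by simp
  have "2 * M \<le> (2 * (2 * (8 * w * t))) ^ w"
    unfolding M_def power_mult_distrib[of 2 "2 * (8 * w * t)"]
    using w power_increasing[of 1 w "2::nat"] by (intro mult_right_mono) auto
  also have "\<dots> \<le> (2 ^ (10 + 4 * u)) ^ w"
  proof (intro power_mono)
    have "2 * (2 * (8 * w * t)) \<le> 2 ^ 10 * (u * u ^ 3)" using u by (simp add: t_def)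
    also have "\<dots> = 2 ^ 10 * u ^ 4" by (simp add: power_numeral_reduce)
    also have "\<dots> \<le> 2 ^ 10 * (2 ^ u) ^ 4"
      using less_exp[of u] by (intro mult_left_mono power_mono) auto
    also have "\<dots> = 2 ^ (10 + 4 * u)" by (simp add: power_add power_mult[symmetric] mult.commute)
    finally show "2 * (2 * (8 * w * t)) \<le> 2 ^ (10 + 4 * u)" .
  qed simp
  finally have "2 * M \<le> 2 ^ ((10 + 4 * u) * w)" by (simp add: power_mult)
  then have "(2 * M) ^ (w + 1) \<le> (2 ^ ((10 + 4 * u) * w)) ^ (w + 1)" by (rule power_mono) simp
  then have "(2 * M) ^ (w + 1) \<le> 2 ^ ((10 + 4 * u) * w * (w + 1))" by (simp only: power_mult)
  moreover have "w + 1 \<le> 2 ^ w" by (simp add: Suc_leI less_exp)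
  ultimately have "(w + 1) * (2 * M) ^ (w + 1) * 2 ^ u \<le> 2 ^ w * 2 ^ ((10 + 4 * u) * w * (w + 1)) * 2 ^ u"
    by (intro mult_right_mono mult_mono) auto
  also have "\<dots> = 2 ^ (w + (10 + 4 * u) * w * (w + 1) + u)" by (simp only: power_add)
  also have "\<dots> \<le> 2 ^ t"
  proof (intro power_increasing)
    have "w * (w + 1) \<le> u * u" using u w by (intro mult_mono) auto
    then have "(10 + 4 * u) * w * (w + 1) \<le> (10 + 4 * u) * (u * u)"
      by (simp only: mult.assoc) (intro mult_left_mono, auto)
    \<comment> \<open>As \<open>u\<close> is at least 2, lower powers are absorbed into the cube,
      leaving a linear comparison.\<close>
    moreover have "u * u * 2 \<le> u * u * u" "u * 2 \<le> u * u"
      using u2 by (intro mult_left_mono; simp)+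
    ultimately show "w + (10 + 4 * u) * w * (w + 1) + u \<le> t"
      using u unfolding t_def power3_eq_cube distrib_right by linarith
  qed simp
  finally have "(w + 1) * (2 * M) ^ (w + 1) * 2 ^ u \<le> 2 ^ t" .
  moreover have "(w + 1) * M * (2 * M) ^ w * 2 ^ u \<le> (w + 1) * (2 * M) * (2 * M) ^ w * 2 ^ u"
    by (intro mult_right_mono mult_left_mono) auto
  then have "(w + 1) * M * (2 * M) ^ w * 2 ^ u \<le> (w + 1) * (2 * M) ^ (w + 1) * 2 ^ u"
    by (simp only: power_add power_one_right mult_ac)
  ultimately show ?thesis by linarith
qed

text \<open>Since \<open>u\<close> is at least 2, the constant \<open>2 ^ 9\<close> costs at most
  \<open>u ^ 9\<close>, so the base is at most \<open>u ^ 13\<close>. The prefactor costs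
  \<open>u ^ 2\<close>, and \<open>2 + 13 * w\<close> is at most \<open>15 * w\<close>.\<close>

lemma parameter_size:
  fixes w u :: nat
  assumes w: "w \<ge> 1" and u: "2 * w \<le> u"
  shows "w * ((w + 1) * (2 * (8 * w * (32 * u ^ 3))) ^ w) \<le> u ^ (15 * w)"
proof -
  have u2: "2 \<le> u" using w u by simp
  have "2 * (8 * w * (32 * u ^ 3)) \<le> 2 ^ 9 * (u * u ^ 3)" using u by simp
  also have "\<dots> \<le> u ^ 9 * (u * u ^ 3)" using u2 by (intro mult_right_mono power_mono) auto
  also have "\<dots> = u ^ 13" by (simp flip: power_add power_Suc)
  finally have "(2 * (8 * w * (32 * u ^ 3))) ^ w \<le> (u ^ 13) ^ w" by (rule power_mono) simp
  then have "w * ((w + 1) * (2 * (8 * w * (32 * u ^ 3))) ^ w) \<le> u * (u * (u ^ 13) ^ w)"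
    using u w by (intro mult_mono) auto
  also have "\<dots> = u ^ (2 + 13 * w)" by (simp add: power_mult power2_eq_square power_add)
  also have "\<dots> \<le> u ^ (15 * w)" using u2 w by (intro power_increasing) auto
  finally show ?thesis .
qed

theorem corollary1p2:
  "\<exists>C::real. C > 0 \<and>
     (\<forall>(n::nat) (w::nat) (\<epsilon>::real) (f :: (nat \<Rightarrow> bool) \<Rightarrow> bool).
        n \<ge> 1 \<longrightarrow> w \<ge> 1 \<longrightarrow> \<epsilon> > 0 \<longrightarrow>
        (\<exists>D. dnf_formula n D \<and> has_width w D \<and> computes n D f) \<longrightarrow>
        (\<exists>(k::nat) (g :: (nat \<Rightarrow> bool) \<Rightarrow> bool).
           junta n k g \<and>
           real k \<le> (real w * log_trunc (1 / \<epsilon>)) powr (C * real w) \<and>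
           approximates n \<epsilon> g f))"
proof (intro exI[of _ "30::real"] conjI allI impI)
  fix n w :: nat and \<epsilon> :: real and f :: "(nat \<Rightarrow> bool) \<Rightarrow> bool"
  assume w: "w \<ge> 1" and \<epsilon>: "\<epsilon> > 0"
    and "\<exists>D. dnf_formula n D \<and> has_width w D \<and> computes n D f"
  then obtain D where D: "dnf_formula n D" "has_width w D" "computes n D f" by blast
  define y where "y = real w * log_trunc (1 / \<epsilon>)"
  \<comment> \<open>Truncating the logarithm at 2 makes \<open>y\<close> at least
    \<open>2 * w\<close>, which gives the hypothesis on \<open>u\<close> in both parameter
    lemmas.\<close>
  define u where "u = nat \<lceil>y\<rceil>"
  define t where "t = 32 * u ^ 3"
  define M where "M = (2 * (8 * w * t)) ^ w"
  have lt: "log_trunc (1 / \<epsilon>) \<ge> 2" by (simp add: log_trunc_def)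
  have "2 * real w \<le> y" using lt w by (simp add: y_def)
  have y2: "2 \<le> y" using \<open>2 * real w \<le> y\<close> w by simp
  have yu: "y \<le> u" "real u \<le> y + 1" using y2 by (auto simp: u_def)
  have u: "2 * w \<le> u" using \<open>2 * real w \<le> y\<close> yu by linarith
  have "t > 0" using u w by (simp add: t_def)
  then obtain G where G: "dnf_formula n G" "has_width w G" "card G \<le> (w + 1) * M"
    "cube_prob n (\<lambda>x. dnf_sat x D \<noteq> dnf_sat x G) \<le> real ((w + 1) * M * (2 * M) ^ w) * (1 / 2) ^ t"
    using dnf_sparsification[of w t "8 * w * t" n D] D w unfolding M_def by auto
  have "junta n (w * card G) (\<lambda>x. dnf_sat x G)" using G by (intro junta_dnf)
  moreover have "real (w * card G) \<le> y powr (30 * real w)"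
  proof -
    have "w * card G \<le> w * ((w + 1) * M)" using G by simp
    also have "\<dots> \<le> u ^ (15 * w)" using parameter_size[OF w u] by (simp add: M_def t_def)
    finally have "real (w * card G) \<le> real u ^ (15 * w)"
      by (metis of_nat_le_iff of_nat_power)
    \<comment> \<open>Undoing the rounding: \<open>u\<close> is at most \<open>y + 1\<close>, hence
      at most \<open>y\<^sup>2\<close>, which doubles the exponent constant 15 to 30.\<close>
    also have "\<dots> \<le> (y\<^sup>2) ^ (15 * w)"
    proof (intro power_mono)
      have "2 * y \<le> y\<^sup>2" unfolding power2_eq_square using y2 by (intro mult_right_mono) auto
      then show "real u \<le> y\<^sup>2" using yu y2 by linarith
    qed simp
    also have "\<dots> = y ^ (30 * w)" by (simp flip: power_mult)
    also have "\<dots> = y powr real (30 * w)" using y2 by (intro powr_realpow[symmetric]) auto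
    finally show ?thesis by simp
  qed
  moreover have "approximates n \<epsilon> (\<lambda>x. dnf_sat x G) f"
  proof -
    have "cube_prob n (\<lambda>x. f x \<noteq> dnf_sat x G) \<le> cube_prob n (\<lambda>x. dnf_sat x D \<noteq> dnf_sat x G)"
      using D(3) by (intro cube_prob_mono) (auto simp: computes_def)
    also note G(4)
    also have "real ((w + 1) * M * (2 * M) ^ w) * (1 / 2) ^ t \<le> (1 / 2) ^ u"
    proof -
      have "real ((w + 1) * M * (2 * M) ^ w * 2 ^ u) \<le> real (2 ^ t)"
        using parameter_error[OF w u] unfolding M_def t_def by (simp only: of_nat_le_iff)
      then show ?thesis by (simp add: power_divide field_simps)
    qed
    also have "\<dots> \<le> \<epsilon>"
    proof -
      have "log 2 (1 / \<epsilon>) \<le> log_trunc (1 / \<epsilon>)" by (simp add: log_trunc_def)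
      also have "\<dots> \<le> y" using lt w by (simp add: y_def)
      also have "\<dots> \<le> u" by (rule yu)
      finally have "1 / \<epsilon> \<le> 2 powr real u" using \<epsilon> by (simp add: log_le_iff)
      then show ?thesis using \<epsilon> by (simp add: powr_realpow power_divide field_simps)
    qed
    finally show ?thesis by (simp add: approximates_def prob_pmf_of_set_cube)
  qed
  ultimately show "\<exists>k g. junta n k g \<and> real k \<le> (real w * log_trunc (1 / \<epsilon>)) powr (30 * real w)
      \<and> approximates n \<epsilon> g f"
    unfolding y_def by blast
qed simp

end
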